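(* Let $\mathbf{X}$ be a real inner product space with norm $|\cdot|$. Given two constants $\delta,\epsilon>0$, consider a convex set $C\subset\mathbf{X}$, a function $f\colon C\to\mathbf{R}$ that is bounded below, an associated $L$-bounded directional subgradient map $G\colon\mathbf{X}^2\to\mathbf{X}$ (where $L>0$), and an initial point $x_0\in C$ such that \[ f(x)\le f(x_0)\ \text{ and }\ |y|\le\delta\quad\Longrightarrow\quad x+y\in C . \] Suppose that $f$ has finite nonconvexity modulus $\Lambda(\delta)$. Then the nonsmooth minimization algorithm (described in the context), started at $x_0$, requires at most \[ \left\lceil \frac{3\,(f(x_0)-\min f)}{\delta\epsilon}\right\rceil\cdot\frac{16L^2}{\epsilon^2}\cdot\Big(1+\Big\lfloor\frac{12\,\Lambda(\delta)}{\epsilon}\Big\rfloor\Big) \] calls to the directional subgradient oracle to find a point $x\in\mathbf{X}$ and a Goldstein subgradient $g\in\partial_\delta f(x)$ satisfying $|g|\le\epsilon$.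
   Context: **Directional subgradient map.** The Gateaux directional derivative is $f'(x;e)=\lim_{t\downarrow0}\frac1t\big(f(x+te)-f(x)\big)$. A directional subgradient map for $f$ is a map $G\colon\mathbf{X}^2\to\mathbf{X}$ such that $f'(x;e)$ exists and $\langle G(x,e),e\rangle=f'(x;e)$ for all points $x$ and directions $e$; for $f$ defined on $C$ this is required for $x\in C$ and $e\in\mathbf{X}$ with $x+te\in C$ for all small $t>0$. $G$ is $L$-bounded if $|G(x,e)|\le L$ for all $x,e$. **Oracle.** The directional subgradient oracle takes as input a point $x$ and a direction $e$, and returns $f(x)$, $f'(x;e)$ and $G(x,e)$. **Goldstein subgradients.** $\partial_\delta f(x)$ is the set of all vectors $\sum_{i=1}^k\lambda_iG(x_i,e_i)$ with $k$ a positive integer, positive weights $\lambda_i$ summing to $1$, points $x_i$ in the closed ball $B_\delta(x)$, and directions $e_i\in\mathbf{X}$. **Concave deviation.** For an interval $J\subset\mathbf{R}$, the concave deviation of $h\colon J\to\mathbf{R}$ is the infimum of the Lipschitz constants of convex functions $s\colon J\to\mathbf{R}$ such that $h+s$ is also convex ($+\infty$ if there are none). **Nonconvexity modulus.** $\Lambda(\delta)\in[0,+\infty]$ is the supremum, over all $x,y\in C$ with $|x-y|\le\delta$, of the concave deviation of the function $h\colon[0,\delta]\to\mathbf{R}$, $h(t)=f\big(x+\frac t\delta(y-x)\big)$. **Bisection algorithm** for a function $h\colon[p,q]\to\mathbf{R}$ with $h(p)>h(q)$ and right derivative $h'_+(t)=\lim_{s\downarrow t}\frac{h(s)-h(t)}{s-t}$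 on $[p,q)$: If $h'_+(p)<0$, return $p$. Otherwise set $l=p$, $r=q$ and repeat: let $m=\frac12(l+r)$; if $h'_+(m)<0$, return $m$; else if $2h(m)<h(l)+h(r)$, set $r=m$; else set $l=m$. **Nonsmooth minimization algorithm.** It maintains a current point $x$ (initially $x_0$) and a current Goldstein subgradient $g\in\partial_\delta f(x)$, and repeats the following: 1. If $|g|\le\epsilon$, stop and return $x$ (with $g$). 2. Let $\hat g=g/|g|$ and $x'=x-\delta\hat g$. 3. If $f(x)-f(x')\ge\frac{\delta\epsilon}{3}$, set $x=x'$ and $g=G(x,0)$ (for the new $x$). 4. Otherwise, define on $[0,\delta]$: $x(t)=x+(t-\delta)\hat g$ and $h(t)=f(x(t))-\frac{\epsilon t}{2}$. Apply the bisection algorithm to $h$ on $[p,q]=[0,\delta]$, using the formula $h'_+(t)=\langle G(x(t),\hat g),\hat g\rangle-\frac\epsilon2$, to find $t\in[0,\delta]$ with $h'_+(t)<0$; then replace $g$ by the shortest vector in the line segment $[g,G(x(t),\hat g)]$. Here $\min f$ denotes the infimum of $f$ on $C$.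
   Formalization: The ceiling is replaced by max(1, ceiling) and the whole bound by max(1, bound): as printed the bound is 0 when f(x_0) = min f (e.g. f=|x|, x_0=0, G(0,0)=1, ε=1/2) and can be below 1 when L < ε/4, though at least one oracle call is needed. *)

theory Defs
  imports "HOL-Analysis.Analysis"
begin

text \<open>A function defined on a set \<open>C\<close> is represented by a total function \<open>f\<close>; only its values on
  \<open>C\<close> matter in what follows.\<close>

definition has_directional_derivative ::
    "('a::real_inner \<Rightarrow> real) \<Rightarrow> 'a \<Rightarrow> 'a \<Rightarrow> real \<Rightarrow> bool" where
  "has_directional_derivative f x e d \<longleftrightarrow>
     ((\<lambda>t. (f (x + t *\<^sub>R e) - f x) / t) \<longlongrightarrow> d) (at_right 0)"

definition directional_derivative :: "('a::real_inner \<Rightarrow> real) \<Rightarrow> 'a \<Rightarrow> 'a \<Rightarrow> real" where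
  "directional_derivative f x e = (THE d. has_directional_derivative f x e d)"

definition directional_subgradient_map ::
    "'a::real_inner set \<Rightarrow> ('a \<Rightarrow> real) \<Rightarrow> ('a \<Rightarrow> 'a \<Rightarrow> 'a) \<Rightarrow> bool" where
  "directional_subgradient_map C f G \<longleftrightarrow>
     (\<forall>x\<in>C. \<forall>e. (\<forall>\<^sub>F t in at_right 0. x + t *\<^sub>R e \<in> C) \<longrightarrow>
        has_directional_derivative f x e (G x e \<bullet> e))"

definition goldstein_subdifferential ::
    "('a::real_inner \<Rightarrow> 'a \<Rightarrow> 'a) \<Rightarrow> real \<Rightarrow> 'a \<Rightarrow> 'a set" where
  "goldstein_subdifferential G \<delta> x =
     {\<Sum>i<k. \<mu> i *\<^sub>R G (y i) (e i) | (k::nat) \<mu> y e.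
        0 < k \<and> (\<forall>i<k. 0 < \<mu> i \<and> y i \<in> cball x \<delta>) \<and> (\<Sum>i<k. \<mu> i) = 1}"

text \<open>The infimum of the empty set is \<open>\<infinity>\<close> in \<^typ>\<open>ennreal\<close>.\<close>

definition concave_deviation :: "real set \<Rightarrow> (real \<Rightarrow> real) \<Rightarrow> ennreal" where
  "concave_deviation J h =
     Inf {ennreal c | c s. c-lipschitz_on J s \<and> convex_on J s \<and> convex_on J (\<lambda>t. h t + s t)}"

definition nonconvexity_modulus ::
    "'a::real_inner set \<Rightarrow> ('a \<Rightarrow> real) \<Rightarrow> real \<Rightarrow> ennreal" where
  "nonconvexity_modulus C f \<delta> =
     Sup {concave_deviation {0..\<delta>} (\<lambda>t. f (x + (t / \<delta>) *\<^sub>R (y - x))) | x y.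
            x \<in> C \<and> y \<in> C \<and> norm (x - y) \<le> \<delta>}"

definition subgradient_oracle ::
    "('a::real_inner \<Rightarrow> real) \<Rightarrow> ('a \<Rightarrow> 'a \<Rightarrow> 'a) \<Rightarrow> 'a \<times> 'a \<Rightarrow> real \<times> real \<times> 'a" where
  "subgradient_oracle f G = (\<lambda>(x, e). (f x, directional_derivative f x e, G x e))"

text \<open>
  The minimization algorithm is an interactive machine: in each state other than \<open>Finished\<close> it
  issues one oracle query, and its next state depends only on its current state and the oracle's
  answer. It has no other access to \<open>f\<close> and \<open>G\<close>, so its transitions are exactly its oracle calls.

  \<^item> \<open>Evaluate x\<close>: \<open>x\<close> has just become the current point; \<open>f x\<close> and \<open>g = G x 0\<close> are requested.
  \<^item> \<open>Probe x a g\<close>: the current point is \<open>x\<close> with \<open>f x = a\<close> and the current Goldstein subgradient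
    \<open>g\<close> is longer than \<open>\<epsilon>\<close>. One call at \<open>x' = x - \<delta> *\<^sub>R sgn g\<close> in the direction \<open>sgn g\<close> yields both
    the value \<open>f x'\<close> for the descent test and the value of \<open>h\<^sub>+'(0)\<close> for the first test of the
    bisection algorithm.
  \<^item> \<open>Bisect x a g l r hl hr\<close>: the bisection algorithm is working on \<open>[l, r]\<close>, with \<open>h l = hl\<close> and
    \<open>h r = hr\<close>, and is about to examine the midpoint.
  \<^item> \<open>Finished x g\<close>: the algorithm has stopped and returned \<open>x\<close> and \<open>g\<close>.
\<close>

datatype 'a machine =
    Evaluate 'a
  | Probe 'a real 'a
  | Bisect 'a real 'a real real real real
  | Finished 'a 'a

definition line_point :: "real \<Rightarrow> 'a::real_inner \<Rightarrow> 'a \<Rightarrow> real \<Rightarrow> 'a" where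
  "line_point \<delta> x g t = x + (t - \<delta>) *\<^sub>R sgn g"

definition shortest_in_segment :: "'a::real_inner \<Rightarrow> 'a \<Rightarrow> 'a" where
  "shortest_in_segment g v = arg_min_on norm (closed_segment g v)"

definition test_stop :: "real \<Rightarrow> 'a::real_inner \<Rightarrow> real \<Rightarrow> 'a \<Rightarrow> 'a machine" where
  "test_stop \<epsilon> x a g = (if norm g \<le> \<epsilon> then Finished x g else Probe x a g)"

fun query :: "real \<Rightarrow> 'a::real_inner machine \<Rightarrow> ('a \<times> 'a) option" where
  "query \<delta> (Evaluate x) = Some (x, 0)"
| "query \<delta> (Probe x a g) = Some (line_point \<delta> x g 0, sgn g)"
| "query \<delta> (Bisect x a g l r hl hr) = Some (line_point \<delta> x g ((l + r) / 2), sgn g)"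
| "query \<delta> (Finished x g) = None"

text \<open>Below, \<open>v \<bullet> sgn g - \<epsilon> / 2\<close> is \<open>h\<^sub>+'(t)\<close> and \<open>b - \<epsilon> * t / 2\<close> is \<open>h t\<close> at the queried point
  \<open>line_point \<delta> x g t\<close>, where \<open>b\<close> is the value of \<open>f\<close> there.\<close>

fun respond ::
    "real \<Rightarrow> real \<Rightarrow> 'a::real_inner machine \<Rightarrow> real \<times> real \<times> 'a \<Rightarrow> 'a machine" where
  "respond \<delta> \<epsilon> (Evaluate x) (b, d, v) = test_stop \<epsilon> x b v"
| "respond \<delta> \<epsilon> (Probe x a g) (b, d, v) =
    (if a - b \<ge> \<delta> * \<epsilon> / 3 then Evaluate (line_point \<delta> x g 0)
     else if v \<bullet> sgn g - \<epsilon> / 2 < 0 then test_stop \<epsilon> x a (shortest_in_segment g v)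
     else Bisect x a g 0 \<delta> b (a - \<epsilon> * \<delta> / 2))"
| "respond \<delta> \<epsilon> (Bisect x a g l r hl hr) (b, d, v) =
    (let m = (l + r) / 2; hm = b - \<epsilon> * m / 2 in
     if v \<bullet> sgn g - \<epsilon> / 2 < 0 then test_stop \<epsilon> x a (shortest_in_segment g v)
     else if 2 * hm < hl + hr then Bisect x a g l m hl hm
     else Bisect x a g m r hm hr)"
| "respond \<delta> \<epsilon> (Finished x g) ans = Finished x g"

text \<open>\<open>returns f G \<delta> \<epsilon> s n x g\<close>: started in state \<open>s\<close>, the algorithm makes exactly \<open>n\<close> oracle calls
  and then stops, returning \<open>x\<close> and \<open>g\<close>.\<close>

inductive returns ::
    "('a::real_inner \<Rightarrow> real) \<Rightarrow> ('a \<Rightarrow> 'a \<Rightarrow> 'a) \<Rightarrow> real \<Rightarrow> real \<Rightarrow>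
      'a machine \<Rightarrow> nat \<Rightarrow> 'a \<Rightarrow> 'a \<Rightarrow> bool"
  for f G \<delta> \<epsilon> where
  stop: "returns f G \<delta> \<epsilon> (Finished x g) 0 x g"
| call: "query \<delta> s = Some q \<Longrightarrow>
    returns f G \<delta> \<epsilon> (respond \<delta> \<epsilon> s (subgradient_oracle f G q)) n x g \<Longrightarrow>
    returns f G \<delta> \<epsilon> s (Suc n) x g"

end

theory Submission
  imports Defs
begin

text \<open>
  The oracle calls are counted on three levels.

  \<^bold>\<open>Bisection.\<close> Let \<open>h t = f (x(t)) - \<epsilon> t / 2\<close> be the function searched by a null step, and let \<open>s\<close>
  be convex and \<open>c\<close>-Lipschitz with \<open>h + s\<close> convex. When the descent test fails, the average decrease
  \<open>\<sigma>\<close> of \<open>h\<close> over the current interval \<open>[l, r]\<close> is more than \<open>\<epsilon>/6\<close> initially, and halving never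
  decreases it. Since \<open>h + s\<close> is convex and the right derivative of \<open>h\<close> at \<open>l\<close> is nonnegative, the
  slopes of \<open>s\<close> on \<open>[l, t]\<close> exceed its right derivative at \<open>l\<close> by at least the average decrease of \<open>h\<close>
  on \<open>[l, t]\<close> (lemma \<open>slope_excess\<close>). Let \<open>V\<close> be an upper bound for the slopes of \<open>s\<close> ending at \<open>r\<close>, minus
  the right derivative of \<open>s\<close> at \<open>l\<close>. Applying the slope inequality to the discarded half shows
  that each halving lowers the potential \<open>V - \<sigma>\<close> by at least \<open>\<sigma> \<ge> \<epsilon>/6\<close>. The potential is
  nonnegative, and \<open>V \<le> 2 c\<close> at the start, so that at most \<open>12 c / \<epsilon>\<close> midpoints are examined
  (lemma \<open>bisection_run\<close>). Taking \<open>c\<close> close enough to the concave deviation and adding the call at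
  \<open>t = 0\<close>, a null step costs at most \<open>M = 1 + \<lfloor>12 \<Lambda>(\<delta>) / \<epsilon>\<rfloor>\<close> calls (lemma \<open>probe_run\<close>).

  \<^bold>\<open>Null steps.\<close> The vector \<open>v\<close> so found satisfies \<open>g \<bullet> v \<le> |g|\<^sup>2 / 2\<close>. Comparing the shortest vector
  of the segment with \<open>(1 - u) g + u v\<close> for \<open>u = |g|\<^sup>2 / (2 L\<^sup>2)\<close> shows that every null step increases
  \<open>4 L\<^sup>2 / |g|\<^sup>2\<close> by at least one. This quantity is at least \<open>4\<close> at the outset and below
  \<open>4 L\<^sup>2 / \<epsilon>\<^sup>2\<close> as long as \<open>|g| > \<epsilon>\<close>, so that fewer than \<open>4 L\<^sup>2 / \<epsilon>\<^sup>2 - 3\<close> null steps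
  share the same current point. The three spare steps pay for the calls that evaluate this point and
  detect a descent, whence at most \<open>T = 4 L\<^sup>2 M / \<epsilon>\<^sup>2\<close> calls per point if \<open>\<epsilon> \<le> L\<close> (lemma
  \<open>test_stop_run\<close>). If \<open>L < \<epsilon>\<close>, the first call already ends the algorithm.

  \<^bold>\<open>Descent steps.\<close> With \<open>D = 3 (f x\<^sub>0 - inf f) / (\<delta> \<epsilon>)\<close> there are at most \<open>\<lfloor>D\<rfloor>\<close> descents, hence
  at most \<open>\<lfloor>D\<rfloor> + 1\<close> current points (lemma \<open>evaluate_run\<close>). This may exceed \<open>\<lceil>D\<rceil>\<close>, but not
  \<open>2 max 1 \<lceil>D\<rceil>\<close>, and the constant \<open>4\<close> in \<open>T\<close> leaves room for this factor below \<open>16\<close>.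
\<close>

section \<open>Chord slopes of convex functions\<close>

text \<open>The right derivative at \<open>l\<close> of a convex Lipschitz function \<open>s\<close>, as the infimum of its
  chord slopes on the right of \<open>l\<close> up to \<open>q\<close>. It is meaningful only for \<open>l < q\<close> and if these slopes are bounded
  below.\<close>

definition right_slope :: "real \<Rightarrow> (real \<Rightarrow> real) \<Rightarrow> real \<Rightarrow> real" where
  "right_slope q s l = (INF t\<in>{l<..q}. (s t - s l) / (t - l))"

lemma lipschitz_on_slope_bounds:
  fixes s :: "real \<Rightarrow> real"
  assumes "c-lipschitz_on J s" "k \<in> J" "l \<in> J" "k < l"
  shows "- c \<le> (s l - s k) / (l - k)" and "(s l - s k) / (l - k) \<le> c"
proof -
  have "\<bar>s l - s k\<bar> \<le> c * (l - k)"
    using lipschitz_onD[OF assms(1), of l k] assms by (simp add: dist_real_def abs_of_pos)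
  then have "- c * (l - k) \<le> s l - s k" "s l - s k \<le> c * (l - k)" by auto
  then show "- c \<le> (s l - s k) / (l - k)" "(s l - s k) / (l - k) \<le> c"
    using \<open>k < l\<close> by (simp_all add: pos_le_divide_eq pos_divide_le_eq)
qed

lemma right_slope_le:
  assumes "c-lipschitz_on {p..q} s" "p \<le> l" "l < t" "t \<le> q"
  shows "right_slope q s l \<le> (s t - s l) / (t - l)"
  unfolding right_slope_def
proof (rule cINF_lower)
  show "bdd_below ((\<lambda>t. (s t - s l) / (t - l)) ` {l<..q})"
    using assms by (intro bdd_belowI2[of _ "- c"] lipschitz_on_slope_bounds(1)[OF assms(1)]) auto
qed (use assms in auto)

lemma right_slope_lower:
  assumes "c-lipschitz_on {p..q} s" "p \<le> l" "l < q"
  shows "- c \<le> right_slope q s l"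
  unfolding right_slope_def
  using assms by (intro cINF_greatest lipschitz_on_slope_bounds(1)[OF assms(1)]) auto

lemma convex_on_slopes:
  fixes s :: "real \<Rightarrow> real"
  assumes "convex_on J s" "k \<in> J" "t \<in> J" "k < l" "l < t"
  shows "(s l - s k) / (l - k) \<le> (s t - s k) / (t - k)"
    and "(s t - s k) / (t - k) \<le> (s t - s l) / (t - l)"
proof -
  have flip: "(a - b) / (u - v) = (b - a) / (v - u)" for a b u v :: real
    by (metis minus_diff_eq minus_divide_divide)
  show "(s l - s k) / (l - k) \<le> (s t - s k) / (t - k)"
    and "(s t - s k) / (t - k) \<le> (s t - s l) / (t - l)"
    using convex_on_slope_le[OF assms] by (simp_all add: flip[of "s k"] flip[of "s l" "s t"])
qed

lemma slope_le_right_slope: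
  assumes "convex_on {p..q} s" "p \<le> k" "k < l" "l < q"
  shows "(s l - s k) / (l - k) \<le> right_slope q s l"
  unfolding right_slope_def
proof (rule cINF_greatest)
  fix t assume "t \<in> {l<..q}"
  then show "(s l - s k) / (l - k) \<le> (s t - s l) / (t - l)"
    using convex_on_slopes[OF assms(1), of k t l] assms by force
qed (use assms in auto)

text \<open>Where \<open>h\<close> starts with a nonnegative right derivative, it can only decrease by way of its
  concave part: any average decrease of \<open>h\<close> on \<open>[l, t]\<close> is bounded by the growth of the slopes of
  \<open>s\<close>, because \<open>h + s\<close> is convex.\<close>

lemma slope_excess:
  assumes lip: "c-lipschitz_on {p..q} s" and conv: "convex_on {p..q} (\<lambda>t. h t + s t)"
    and lim: "((\<lambda>\<tau>. (h (l + \<tau>) - h l) / \<tau>) \<longlongrightarrow> d) (at_right 0)" and "0 \<le> d"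
    and "p \<le> l" "l < t" "t \<le> q"
  shows "(h l - h t) / (t - l) \<le> (s t - s l) / (t - l) - right_slope q s l"
proof -
  have "d \<le> (h t + s t - (h l + s l)) / (t - l) - right_slope q s l"
  proof (rule tendsto_upperbound[OF lim])
    have "\<forall>\<^sub>F \<tau> in at_right 0. \<tau> \<in> {0<..<t - l}"
      using assms by (intro eventually_at_right_real) auto
    then show "\<forall>\<^sub>F \<tau> in at_right 0. (h (l + \<tau>) - h l) / \<tau>
        \<le> (h t + s t - (h l + s l)) / (t - l) - right_slope q s l"
    proof eventually_elim
      case (elim \<tau>)
      have "(h (l + \<tau>) - h l) / \<tau> + (s (l + \<tau>) - s l) / \<tau>
          \<le> (h t + s t - (h l + s l)) / (t - l)"
        using convex_on_slopes(1)[OF conv, of l t "l + \<tau>"] elim assms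
        by (simp add: add_divide_distrib diff_divide_distrib)
      moreover have "right_slope q s l \<le> (s (l + \<tau>) - s l) / \<tau>"
        using right_slope_le[OF lip, of l "l + \<tau>"] elim assms by simp
      ultimately show ?case by linarith
    qed
  qed simp
  then show ?thesis
    using \<open>0 \<le> d\<close> by (simp add: add_divide_distrib diff_divide_distrib)
qed

section \<open>The cost of the bisection algorithm\<close>

text \<open>Here \<open>K\<close> is the number of midpoints examined, at one oracle call each, until one with negative
  right derivative is found. Up to a summand \<open>\<epsilon> / 6\<close>, the
  quantity bounding \<open>K (\<epsilon> / 6)\<close> is the potential \<open>(U - right_slope \<delta> s l) - \<sigma>\<close> with \<open>\<sigma> = (h l - h r) / (r - l)\<close>, where \<open>U\<close> bounds the slopes of \<open>s\<close>
  on the intervals \<open>[t, r]\<close>. The last conjunct lets a run be composed with whatever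
  follows the bisection.\<close>

lemma bisection_run:
  fixes f :: "'a::real_inner \<Rightarrow> real" and h h' s :: "real \<Rightarrow> real"
  assumes h: "\<And>t. h t = f (line_point \<delta> x g t) - \<epsilon> * t / 2"
    and h': "\<And>t. h' t = G (line_point \<delta> x g t) (sgn g) \<bullet> sgn g - \<epsilon> / 2"
    and "0 < \<epsilon>"
    and deriv: "\<And>t. 0 \<le> t \<Longrightarrow> t < \<delta> \<Longrightarrow>
      ((\<lambda>\<tau>. (h (t + \<tau>) - h t) / \<tau>) \<longlongrightarrow> h' t) (at_right 0)"
    and lip: "c-lipschitz_on {0..\<delta>} s" and convs: "convex_on {0..\<delta>} s"
    and convh: "convex_on {0..\<delta>} (\<lambda>t. h t + s t)"
    and lr: "0 \<le> l" "l < r" "r \<le> \<delta>" and "0 \<le> h' l"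
    and drop: "\<epsilon> / 6 \<le> (h l - h r) / (r - l)"
    and upper: "\<And>t. l \<le> t \<Longrightarrow> t < r \<Longrightarrow> (s r - s t) / (r - t) \<le> U"
  shows "\<exists>K t. real K * (\<epsilon> / 6)
        \<le> U - right_slope \<delta> s l - (h l - h r) / (r - l) + \<epsilon> / 6 \<and>
      0 \<le> t \<and> t < \<delta> \<and> h' t < 0 \<and>
      (\<forall>n y w. returns f G \<delta> \<epsilon>
          (test_stop \<epsilon> x a (shortest_in_segment g (G (line_point \<delta> x g t) (sgn g)))) n y w \<longrightarrow>
        returns f G \<delta> \<epsilon> (Bisect x a g l r (h l) (h r)) (K + n) y w)"
proof -
  let ?D = "right_slope \<delta> s"
  define e where "e = \<epsilon> / 6"
  then have "0 < e" using \<open>0 < \<epsilon>\<close> by simp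
  define \<sigma> where "\<sigma> l r = (h l - h r) / (r - l)" for l r
  let ?Q = "\<lambda>l r U K t. real K * e \<le> U - ?D l - \<sigma> l r + e \<and>
      0 \<le> t \<and> t < \<delta> \<and> h' t < 0 \<and>
      (\<forall>n y w. returns f G \<delta> \<epsilon>
          (test_stop \<epsilon> x a (shortest_in_segment g (G (line_point \<delta> x g t) (sgn g)))) n y w \<longrightarrow>
        returns f G \<delta> \<epsilon> (Bisect x a g l r (h l) (h r)) (K + n) y w)"
  have excess: "\<sigma> l t \<le> (s t - s l) / (t - l) - ?D l"
    if "0 \<le> l" "l < t" "t \<le> \<delta>" "0 \<le> h' l" for l t
    unfolding \<sigma>_def using slope_excess[OF lip convh deriv] that by auto
  \<comment> \<open>The potential loses at least \<open>e\<close> in each halving, so a multiple of \<open>e\<close> above it bounds the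
    depth of the recursion.\<close>
  obtain N :: nat where "U - ?D l - \<sigma> l r < real N * e"
    using reals_Archimedean3[OF \<open>0 < e\<close>] by blast
  then have "\<exists>K t. ?Q l r U K t"
    using lr \<open>0 \<le> h' l\<close> drop[folded \<sigma>_def e_def] upper
  proof (induction N arbitrary: l r U)
    case 0
    then have "0 \<le> U - ?D l - \<sigma> l r"
      using excess[of l r] 0(7)[of l] by fastforce
    with 0(1) show ?case by simp
  next
    case (Suc N)
    define m where "m = (l + r) / 2"
    have m: "0 \<le> m" "l < m" "m < r" "m < \<delta>"
      using Suc.prems by (auto simp: m_def)
    have query: "query \<delta> (Bisect x a g l r (h l) (h r)) = Some (line_point \<delta> x g m, sgn g)"
      by (simp add: m_def)
    have W: "0 \<le> U - ?D l - \<sigma> l r"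
      using excess[OF Suc.prems(2-5)] Suc.prems(7)[OF order_refl Suc.prems(3)] by linarith
    show ?case
    proof (cases "h' m < 0")
      case True
      then have resp: "respond \<delta> \<epsilon> (Bisect x a g l r (h l) (h r))
            (subgradient_oracle f G (line_point \<delta> x g m, sgn g))
          = test_stop \<epsilon> x a (shortest_in_segment g (G (line_point \<delta> x g m) (sgn g)))"
        by (simp add: subgradient_oracle_def h' Let_def)
      have "?Q l r U 1 m"
        using W m True returns.call[OF query, where f = f and G = G and \<epsilon> = \<epsilon>, unfolded resp]
        by auto
      then show ?thesis by blast
    next
      case False
      have budget: "U - ?D l - \<sigma> l r < real N * e + e"
        using Suc.prems(1) by (simp only: of_nat_Suc distrib_right)
      have halves: "2 * \<sigma> l r = \<sigma> l m + \<sigma> m r"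
      proof -
        have half: "r - l = 2 * (r - m)" "m - l = r - m"
          by (simp_all add: m_def field_simps)
        have "2 * ((u - w) / (2 * d)) = (u - v) / d + (v - w) / d" for u v w d :: real
          by (simp add: diff_divide_distrib)
        then show ?thesis unfolding half \<sigma>_def .
      qed
      have test: "2 * h m < h l + h r \<longleftrightarrow> \<sigma> m r < \<sigma> l m"
      proof -
        have half: "m - l = r - m" by (simp add: m_def field_simps)
        show ?thesis
          unfolding half \<sigma>_def divide_less_cancel using \<open>m < r\<close> by auto
      qed
      show ?thesis
      proof (cases "2 * h m < h l + h r")
        case True
        \<comment> \<open>The half \<open>[m, r]\<close> is discarded: the right derivative of \<open>s\<close> at \<open>m\<close> replaces \<open>U\<close>.\<close>
        have "?D m + \<sigma> m r \<le> U"
          using excess[of m r] Suc.prems(7)[of m] Suc.prems(4) m False by linarith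
        then have "?D m - ?D l - \<sigma> l m < real N * e"
          using budget halves Suc.prems(6) by linarith
        moreover have "e \<le> \<sigma> l m"
          using Suc.prems(6) True halves unfolding test by linarith
        moreover have "(s m - s t) / (m - t) \<le> ?D m" if "l \<le> t" "t < m" for t
          using that m Suc.prems(2) by (intro slope_le_right_slope[OF convs]) auto
        ultimately have "\<exists>K t. ?Q l m (?D m) K t"
          using Suc.prems(2,5) m by (intro Suc.IH) auto
        then obtain K t where Q: "?Q l m (?D m) K t" by blast
        have resp: "respond \<delta> \<epsilon> (Bisect x a g l r (h l) (h r))
            (subgradient_oracle f G (line_point \<delta> x g m, sgn g))
          = Bisect x a g l m (h l) (h m)"
          using True False by (simp add: subgradient_oracle_def h' h m_def Let_def)
        have "real K * e \<le> ?D m - ?D l - \<sigma> l m + e"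
          using Q by blast
        then have K: "real (Suc K) * e \<le> U - ?D l - \<sigma> l r + e"
          using \<open>?D m + \<sigma> m r \<le> U\<close> halves Suc.prems(6) unfolding of_nat_Suc distrib_right by linarith
        have "?Q l r U (Suc K) t"
          using Q K returns.call[OF query, where f = f and G = G and \<epsilon> = \<epsilon>, unfolded resp]
          by auto
        then show ?thesis by blast
      next
        case right: False
        \<comment> \<open>The half \<open>[l, m]\<close> is discarded: the right derivative of \<open>s\<close> increases from \<open>l\<close> to \<open>m\<close>.\<close>
        have "?D l + \<sigma> l m \<le> ?D m"
          using excess[of l m] slope_le_right_slope[OF convs, of l m] m Suc.prems(2,5) by linarith
        then have "U - ?D m - \<sigma> m r < real N * e"
          using budget halves Suc.prems(6) by linarith
        moreover have "e \<le> \<sigma> m r"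
          using Suc.prems(6) right halves unfolding test by linarith
        ultimately have "\<exists>K t. ?Q m r U K t"
          using Suc.prems(4,7) m False by (intro Suc.IH) auto
        then obtain K t where Q: "?Q m r U K t" by blast
        have resp: "respond \<delta> \<epsilon> (Bisect x a g l r (h l) (h r))
            (subgradient_oracle f G (line_point \<delta> x g m, sgn g))
          = Bisect x a g m r (h m) (h r)"
          using right False by (simp add: subgradient_oracle_def h' h m_def Let_def)
        have "real K * e \<le> U - ?D m - \<sigma> m r + e"
          using Q by blast
        then have K: "real (Suc K) * e \<le> U - ?D l - \<sigma> l r + e"
          using \<open>?D l + \<sigma> l m \<le> ?D m\<close> halves Suc.prems(6) unfolding of_nat_Suc distrib_right by linarith
        have "?Q l r U (Suc K) t"
          using Q K returns.call[OF query, where f = f and G = G and \<epsilon> = \<epsilon>, unfolded resp]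
          by auto
        then show ?thesis by blast
      qed
    qed
  qed
  then show ?thesis unfolding \<sigma>_def e_def .
qed

section \<open>Goldstein subgradients and the shortest vector in a segment\<close>

lemma goldstein_base:
  assumes "y \<in> cball x \<delta>"
  shows "G y e \<in> goldstein_subdifferential G \<delta> x"
proof -
  have "G y e = (\<Sum>i<(1::nat). 1 *\<^sub>R G y e)" by simp
  then show ?thesis
    unfolding goldstein_subdifferential_def using assms
    by (intro CollectI exI[of _ "1::nat"] exI[of _ "\<lambda>_. 1"] exI[of _ "\<lambda>_. y"] exI[of _ "\<lambda>_. e"]) auto
qed

lemma goldstein_combine:
  assumes g: "g \<in> goldstein_subdifferential G \<delta> x" and y: "y \<in> cball x \<delta>"
    and w: "w \<in> closed_segment g (G y e)"
  shows "w \<in> goldstein_subdifferential G \<delta> x"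
proof -
  obtain u where u: "0 \<le> u" "u \<le> 1" "w = (1 - u) *\<^sub>R g + u *\<^sub>R G y e"
    using w by (auto simp: in_segment)
  consider "u = 0" | "u = 1" | "0 < u" "u < 1" using u by linarith
  then show ?thesis
  proof cases
    case 3
    obtain k :: nat and \<mu> z d where k: "0 < k" "\<And>i. i < k \<Longrightarrow> 0 < \<mu> i \<and> z i \<in> cball x \<delta>"
        "(\<Sum>i<k. \<mu> i) = 1" "g = (\<Sum>i<k. \<mu> i *\<^sub>R G (z i) (d i))"
      using g by (auto simp: goldstein_subdifferential_def)
    define \<nu> where "\<nu> i = (if i < k then (1 - u) * \<mu> i else u)" for i
    define z' where "z' i = (if i < k then z i else y)" for i
    define d' where "d' i = (if i < k then d i else e)" for i
    have "w = (\<Sum>i<Suc k. \<nu> i *\<^sub>R G (z' i) (d' i))"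
      by (simp add: u(3) k(4) \<nu>_def z'_def d'_def scaleR_sum_right)
    moreover have "(\<Sum>i<Suc k. \<nu> i) = 1"
      by (simp add: \<nu>_def flip: sum_distrib_left) (simp add: k)
    moreover have "\<forall>i<Suc k. 0 < \<nu> i \<and> z' i \<in> cball x \<delta>"
      using k(2) y 3 by (auto simp: \<nu>_def z'_def)
    ultimately show ?thesis
      unfolding goldstein_subdifferential_def by blast
  qed (use u g goldstein_base[OF y] in auto)
qed

lemma shortest_in_segment:
  shows "shortest_in_segment g v \<in> closed_segment g v"
    and "w \<in> closed_segment g v \<Longrightarrow> norm (shortest_in_segment g v) \<le> norm w"
proof -
  have "\<exists>z\<in>closed_segment g v. \<forall>w\<in>closed_segment g v. norm z \<le> norm w"
    by (intro continuous_attains_inf compact_segment continuous_intros) auto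
  then obtain z where "is_arg_min norm (\<lambda>w. w \<in> closed_segment g v) z"
    by (auto simp: is_arg_min_linorder)
  then have "is_arg_min norm (\<lambda>w. w \<in> closed_segment g v) (shortest_in_segment g v)"
    unfolding shortest_in_segment_def arg_min_on_def arg_min_def by (rule someI)
  then show "shortest_in_segment g v \<in> closed_segment g v"
    and "w \<in> closed_segment g v \<Longrightarrow> norm (shortest_in_segment g v) \<le> norm w"
    by (auto simp: is_arg_min_linorder)
qed

text \<open>The estimate with \<open>4 L\<^sup>2\<close> in the denominator uses the bound on \<open>v\<close> itself; bounding
  \<open>norm (v - g)\<close> by \<open>2 L\<close> would only give \<open>16 L\<^sup>2\<close>.\<close>

lemma norm_shortest_in_segment:
  fixes g v :: "'a::real_inner"
  assumes "0 < L" "norm g \<le> L" "norm v \<le> L" and gv: "g \<bullet> v \<le> (norm g)\<^sup>2 / 2"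
  shows "(norm (shortest_in_segment g v))\<^sup>2 \<le> (norm g)\<^sup>2 - ((norm g)\<^sup>2)\<^sup>2 / (4 * L\<^sup>2)"
proof -
  define a where "a = (norm g)\<^sup>2"
  \<comment> \<open>The minimizer of \<open>a - u a + u\<^sup>2 L\<^sup>2\<close>, the upper bound for \<open>(norm w)\<^sup>2\<close> below.\<close>
  define u where "u = a / (2 * L\<^sup>2)"
  have "a \<le> L\<^sup>2" "(norm v)\<^sup>2 \<le> L\<^sup>2" "0 \<le> a" using assms by (auto simp: a_def power_mono)
  then have u: "0 \<le> u" "u \<le> 1" using \<open>0 < L\<close> by (auto simp: u_def divide_simps)
  define w where "w = (1 - u) *\<^sub>R g + u *\<^sub>R v"
  have "norm (shortest_in_segment g v) \<le> norm w"
    using u by (intro shortest_in_segment(2)) (auto simp: w_def in_segment)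
  then have "(norm (shortest_in_segment g v))\<^sup>2 \<le> (norm w)\<^sup>2" by (simp add: power_mono)
  also have "(norm w)\<^sup>2 = (1 - u)\<^sup>2 * a + 2 * (u * (1 - u)) * (g \<bullet> v) + u\<^sup>2 * (norm v)\<^sup>2"
    unfolding w_def a_def power2_norm_eq_inner
    by (simp add: inner_add inner_commute[of v g] power2_eq_square algebra_simps)
  also have "\<dots> \<le> (1 - u)\<^sup>2 * a + 2 * (u * (1 - u)) * (a / 2) + u\<^sup>2 * L\<^sup>2"
    using u gv \<open>(norm v)\<^sup>2 \<le> L\<^sup>2\<close> by (intro add_mono mult_left_mono) (auto simp: a_def)
  also have "\<dots> = a - u * a + u\<^sup>2 * L\<^sup>2" by (simp add: power2_eq_square algebra_simps)
  also have "\<dots> = a - a\<^sup>2 / (4 * L\<^sup>2)"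
    using \<open>0 < L\<close> by (simp add: u_def power2_eq_square field_simps)
  finally show ?thesis by (simp add: a_def)
qed

section \<open>One null step\<close>

lemma line_point_in_cball:
  assumes "0 \<le> t" "t \<le> \<delta>"
  shows "line_point \<delta> x g t \<in> cball x \<delta>"
  using assms by (auto simp: line_point_def dist_norm norm_sgn)

lemma right_derivative_line_point:
  assumes G: "directional_subgradient_map C f G" and ball: "cball x \<delta> \<subseteq> C"
    and t: "0 \<le> t" "t < \<delta>"
  shows "((\<lambda>\<tau>. (f (line_point \<delta> x g (t + \<tau>)) - f (line_point \<delta> x g t)) / \<tau>)
    \<longlongrightarrow> G (line_point \<delta> x g t) (sgn g) \<bullet> sgn g) (at_right 0)"
proof -
  have shift: "line_point \<delta> x g t + \<tau> *\<^sub>R sgn g = line_point \<delta> x g (t + \<tau>)" for \<tau>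
    by (simp add: line_point_def algebra_simps)
  have "\<forall>\<^sub>F \<tau> in at_right 0. \<tau> \<in> {0<..<\<delta> - t}"
    using t by (intro eventually_at_right_real) auto
  then have "\<forall>\<^sub>F \<tau> in at_right 0. line_point \<delta> x g (t + \<tau>) \<in> C"
  proof eventually_elim
    case (elim \<tau>)
    then show ?case
      using ball t line_point_in_cball[of "t + \<tau>" \<delta> x g] by auto
  qed
  moreover have "line_point \<delta> x g t \<in> C"
    using ball t line_point_in_cball[of t \<delta> x g] by auto
  ultimately have "has_directional_derivative f (line_point \<delta> x g t) (sgn g)
      (G (line_point \<delta> x g t) (sgn g) \<bullet> sgn g)"
    using G by (simp add: directional_subgradient_map_def shift)
  then show ?thesis
    by (simp add: has_directional_derivative_def shift)
qed

text \<open>A null step: \<open>K\<close> oracle calls lead from \<open>Probe\<close> to the next stopping test, including the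
  call that serves both the descent test and the first test of the bisection.\<close>

lemma probe_run:
  fixes f :: "'a::real_inner \<Rightarrow> real"
  assumes "0 < \<delta>" "0 < \<epsilon>" and G: "directional_subgradient_map C f G"
    and ball: "cball x \<delta> \<subseteq> C" and fin: "nonconvexity_modulus C f \<delta> < \<infinity>"
    and "g \<noteq> 0" and nodescent: "f x - f (line_point \<delta> x g 0) < \<delta> * \<epsilon> / 3"
  shows "\<exists>K y. real K \<le> 1 + real_of_int \<lfloor>12 * enn2real (nonconvexity_modulus C f \<delta>) / \<epsilon>\<rfloor> \<and>
    y \<in> cball x \<delta> \<and> G y (sgn g) \<bullet> sgn g < \<epsilon> / 2 \<and>
    (\<forall>n z w. returns f G \<delta> \<epsilon> (test_stop \<epsilon> x (f x) (shortest_in_segment g (G y (sgn g)))) n z w \<longrightarrow>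
      returns f G \<delta> \<epsilon> (Probe x (f x) g) (K + n) z w)"
    (is "\<exists>K y. ?Q K y")
proof -
  define \<Lambda> where "\<Lambda> = enn2real (nonconvexity_modulus C f \<delta>)"
  define h where "h t = f (line_point \<delta> x g t) - \<epsilon> * t / 2" for t
  define h' where "h' t = G (line_point \<delta> x g t) (sgn g) \<bullet> sgn g - \<epsilon> / 2" for t
  have query: "query \<delta> (Probe x (f x) g) = Some (line_point \<delta> x g 0, sgn g)"
    by simp
  have "0 \<le> 12 * \<Lambda> / \<epsilon>" using \<open>0 < \<epsilon>\<close> by (simp add: \<Lambda>_def)
  show ?thesis
  proof (cases "h' 0 < 0")
    case True
    then have resp: "respond \<delta> \<epsilon> (Probe x (f x) g) (subgradient_oracle f G (line_point \<delta> x g 0, sgn g))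
        = test_stop \<epsilon> x (f x) (shortest_in_segment g (G (line_point \<delta> x g 0) (sgn g)))"
      using nodescent by (simp add: subgradient_oracle_def h'_def)
    have "?Q 1 (line_point \<delta> x g 0)"
      using True returns.call[OF query, where f = f and G = G and \<epsilon> = \<epsilon>, unfolded resp]
        \<open>0 \<le> 12 * \<Lambda> / \<epsilon>\<close> line_point_in_cball[of 0 \<delta> x g]
        \<open>0 < \<delta>\<close> by (auto simp: h'_def \<Lambda>_def)
    then show ?thesis by blast
  next
    case False
    have end_pt: "line_point \<delta> x g \<delta> = x" by (simp add: line_point_def)
    have resp: "respond \<delta> \<epsilon> (Probe x (f x) g) (subgradient_oracle f G (line_point \<delta> x g 0, sgn g))
        = Bisect x (f x) g 0 \<delta> (h 0) (h \<delta>)"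
      using nodescent False by (simp add: subgradient_oracle_def h'_def h_def end_pt)
    define N where "N = 1 + \<lfloor>12 * \<Lambda> / \<epsilon>\<rfloor>"
    \<comment> \<open>The concave deviation need not be attained, but the Lipschitz constant \<open>c\<close> can be chosen close
      enough to it that \<open>12 c / \<epsilon> < N\<close>.\<close>
    have "12 * \<Lambda> / \<epsilon> < real_of_int N" unfolding N_def by linarith
    then have "\<Lambda> < real_of_int N * \<epsilon> / 12" using \<open>0 < \<epsilon>\<close> by (simp add: field_simps)
    have "concave_deviation {0..\<delta>} (\<lambda>t. f (line_point \<delta> x g t)) \<le> nonconvexity_modulus C f \<delta>"
      unfolding nonconvexity_modulus_def
    proof (rule Sup_upper, intro CollectI exI conjI)
      let ?y = "line_point \<delta> x g 0"
      show "concave_deviation {0..\<delta>} (\<lambda>t. f (line_point \<delta> x g t))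
          = concave_deviation {0..\<delta>} (\<lambda>t. f (?y + (t / \<delta>) *\<^sub>R (x - ?y)))"
        using \<open>0 < \<delta>\<close> by (simp add: line_point_def algebra_simps)
      show "?y \<in> C" "x \<in> C"
        using ball \<open>0 < \<delta>\<close> line_point_in_cball[of 0 \<delta> x g] by auto
      show "norm (?y - x) \<le> \<delta>"
        using \<open>0 < \<delta>\<close> by (simp add: line_point_def norm_sgn)
    qed
    also have "\<dots> = ennreal \<Lambda>" using fin by (simp add: \<Lambda>_def ennreal_enn2real)
    also have "\<dots> < ennreal (real_of_int N * \<epsilon> / 12)"
      using \<open>\<Lambda> < _\<close> by (simp add: ennreal_less_iff \<Lambda>_def)
    finally obtain c s where lip: "c-lipschitz_on {0..\<delta>} s" and convs: "convex_on {0..\<delta>} s"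
      and convf: "convex_on {0..\<delta>} (\<lambda>t. f (line_point \<delta> x g t) + s t)"
      and "ennreal c < ennreal (real_of_int N * \<epsilon> / 12)"
      unfolding concave_deviation_def Inf_less_iff by blast
    then have c: "c < real_of_int N * \<epsilon> / 12"
      using lipschitz_on_nonneg[OF lip] by (simp add: ennreal_less_iff)
    have "convex_on {0..\<delta>} (\<lambda>t. - (\<epsilon> / 2) * t)"
      by (intro convex_onI) (auto simp: field_simps)
    from convex_on_add[OF convf this] have convh: "convex_on {0..\<delta>} (\<lambda>t. h t + s t)"
      by (simp add: h_def algebra_simps)
    have deriv: "((\<lambda>\<tau>. (h (t + \<tau>) - h t) / \<tau>) \<longlongrightarrow> h' t) (at_right 0)" if "0 \<le> t" "t < \<delta>" for t
    proof (rule Lim_transform_eventually)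
      show "((\<lambda>\<tau>. (f (line_point \<delta> x g (t + \<tau>)) - f (line_point \<delta> x g t)) / \<tau> - \<epsilon> / 2)
          \<longlongrightarrow> h' t) (at_right 0)"
        unfolding h'_def by (intro tendsto_intros right_derivative_line_point[OF G ball that])
      show "\<forall>\<^sub>F \<tau> in at_right 0.
          (f (line_point \<delta> x g (t + \<tau>)) - f (line_point \<delta> x g t)) / \<tau> - \<epsilon> / 2 = (h (t + \<tau>) - h t) / \<tau>"
        using eventually_at_right_less[of 0]
        by eventually_elim (simp add: h_def field_simps)
    qed
    have "\<delta> * \<epsilon> / 6 \<le> h 0 - h \<delta>"
      using nodescent by (simp add: h_def end_pt algebra_simps)
    then have drop: "\<epsilon> / 6 \<le> (h 0 - h \<delta>) / (\<delta> - 0)"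
      using \<open>0 < \<delta>\<close> by (simp add: field_simps)
    have upper: "(s \<delta> - s t) / (\<delta> - t) \<le> c" if "0 \<le> t" "t < \<delta>" for t
      using that by (intro lipschitz_on_slope_bounds(2)[OF lip]) auto
    obtain K t where K: "real K * (\<epsilon> / 6) \<le> c - right_slope \<delta> s 0 - (h 0 - h \<delta>) / (\<delta> - 0) + \<epsilon> / 6"
      and t: "0 \<le> t" "t < \<delta>" "h' t < 0"
      and run: "\<forall>n z w. returns f G \<delta> \<epsilon>
            (test_stop \<epsilon> x (f x) (shortest_in_segment g (G (line_point \<delta> x g t) (sgn g)))) n z w \<longrightarrow>
          returns f G \<delta> \<epsilon> (Bisect x (f x) g 0 \<delta> (h 0) (h \<delta>)) (K + n) z w"
      using bisection_run[where h = h and h' = h' and x = x and g = g and \<delta> = \<delta> and f = f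
          and G = G and s = s and \<epsilon> = \<epsilon> and c = c and l = 0 and r = \<delta> and U = c and a = "f x",
          OF h_def h'_def \<open>0 < \<epsilon>\<close> deriv lip convs convh _ _ _ _ drop upper]
        \<open>0 < \<delta>\<close> False by force
    have "real K * (\<epsilon> / 6) < real_of_int N * (\<epsilon> / 6)"
      using K right_slope_lower[OF lip, of 0] drop c \<open>0 < \<delta>\<close> by simp
    then have "real K < real_of_int N" using \<open>0 < \<epsilon>\<close> by simp
    then have "int K < N" by linarith
    then have "int (Suc K) \<le> N" by linarith
    then have "real (Suc K) \<le> real_of_int N" by (metis of_int_le_iff of_int_of_nat_eq)
    moreover have "line_point \<delta> x g t \<in> cball x \<delta>" using t by (intro line_point_in_cball) auto
    ultimately have "?Q (Suc K) (line_point \<delta> x g t)"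
      using t(3) run returns.call[OF query, where f = f and G = G and \<epsilon> = \<epsilon>, unfolded resp]
      by (auto simp: h'_def N_def \<Lambda>_def)
    then show ?thesis by blast
  qed
qed

section \<open>Counting the null steps and the descent steps\<close>

lemma inverse_norm_growth:
  fixes a b L :: real
  assumes "0 < L" "0 < a" "0 < b" "b \<le> a - a\<^sup>2 / (4 * L\<^sup>2)"
  shows "4 * L\<^sup>2 / a + 1 \<le> 4 * L\<^sup>2 / b"
proof -
  define A where "A = 4 * L\<^sup>2"
  have "0 < A" using assms by (simp add: A_def)
  have "b * (A + a) \<le> (a - a\<^sup>2 / A) * (A + a)"
    using assms \<open>0 < A\<close> by (intro mult_right_mono) (auto simp: A_def)
  also have "\<dots> = a * A - a\<^sup>2 * a / A"
    using \<open>0 < A\<close> by (simp add: field_simps power2_eq_square)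
  also have "\<dots> \<le> a * A" using assms \<open>0 < A\<close> by simp
  finally have "(A + a) / a \<le> A / b" using assms by (simp add: field_simps)
  then show ?thesis using assms by (simp add: A_def add_divide_distrib)
qed

text \<open>The calls made from a stopping test at a fixed current point \<open>x\<close> onwards, where \<open>B\<close> bounds those
  made after the next descent. The difference \<open>4 L\<^sup>2 / \<epsilon>\<^sup>2 - 4 L\<^sup>2 / (norm g)\<^sup>2\<close> is positive while
  \<open>norm g > \<epsilon>\<close> and loses at least one per null step. The extra \<open>1\<close> accounts for a last null step after
  which \<open>norm g \<le> \<epsilon>\<close>, or for the call that detects a descent.\<close>

lemma test_stop_run:
  fixes f :: "'a::real_inner \<Rightarrow> real" and \<delta> \<epsilon> L \<Lambda> :: real and C
  defines "\<Lambda> \<equiv> enn2real (nonconvexity_modulus C f \<delta>)"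
  defines "M \<equiv> 1 + real_of_int \<lfloor>12 * \<Lambda> / \<epsilon>\<rfloor>"
  assumes pos: "0 < \<delta>" "0 < \<epsilon>" "0 < L" and G: "directional_subgradient_map C f G"
    and bound: "\<And>x e. norm (G x e) \<le> L"
    and ball: "cball x \<delta> \<subseteq> C" and fin: "nonconvexity_modulus C f \<delta> < \<infinity>" and "0 \<le> B"
    and descent: "\<And>x'. x' \<in> C \<Longrightarrow> \<delta> * \<epsilon> / 3 \<le> f x - f x' \<Longrightarrow>
      \<exists>n y w. returns f G \<delta> \<epsilon> (Evaluate x') n y w \<and> w \<in> goldstein_subdifferential G \<delta> y \<and>
        norm w \<le> \<epsilon> \<and> real n \<le> B"
    and g: "g \<in> goldstein_subdifferential G \<delta> x" "norm g \<le> L"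
  shows "\<exists>n y w. returns f G \<delta> \<epsilon> (test_stop \<epsilon> x (f x) g) n y w \<and>
    w \<in> goldstein_subdifferential G \<delta> y \<and> norm w \<le> \<epsilon> \<and>
    real n \<le> (if norm g \<le> \<epsilon> then 0
      else (4 * L\<^sup>2 / \<epsilon>\<^sup>2 - 4 * L\<^sup>2 / (norm g)\<^sup>2 + 1) * M + B)"
    (is "\<exists>n y w. ?R g n y w")
proof -
  let ?\<rho> = "\<lambda>g. 4 * L\<^sup>2 / \<epsilon>\<^sup>2 - 4 * L\<^sup>2 / (norm g)\<^sup>2"
  have "1 \<le> M" using pos by (simp add: M_def \<Lambda>_def)
  have rho_pos: "0 < ?\<rho> g" if "\<epsilon> < norm g" for g :: 'a
    using that pos power_strict_mono[OF that, of 2] by (auto intro!: divide_strict_left_mono mult_pos_pos)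
  obtain N :: nat where "?\<rho> g < real N" using reals_Archimedean2 by blast
  then show ?thesis using g
  proof (induction N arbitrary: g)
    case (0 g)
    then have "norm g \<le> \<epsilon>" using rho_pos[of g] by force
    then show ?case using 0 by (auto simp: test_stop_def intro: returns.stop)
  next
    case (Suc N g)
    show ?case
    proof (cases "norm g \<le> \<epsilon>")
      case True
      then show ?thesis using Suc.prems by (auto simp: test_stop_def intro: returns.stop)
    next
      case False
      then have "\<epsilon> < norm g" "g \<noteq> 0" using pos by auto
      have start: "test_stop \<epsilon> x (f x) g = Probe x (f x) g" using False by (simp add: test_stop_def)
      show ?thesis
      proof (cases "\<delta> * \<epsilon> / 3 \<le> f x - f (line_point \<delta> x g 0)")
        case True
        have "line_point \<delta> x g 0 \<in> C" using ball pos line_point_in_cball[of 0 \<delta> x g] by auto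
        then obtain n y w where n: "returns f G \<delta> \<epsilon> (Evaluate (line_point \<delta> x g 0)) n y w"
          "w \<in> goldstein_subdifferential G \<delta> y" "norm w \<le> \<epsilon>" "real n \<le> B"
          using descent[OF _ True] by blast
        have "returns f G \<delta> \<epsilon> (Probe x (f x) g) (Suc n) y w"
          using n(1) True by (intro returns.call[OF query.simps(2)]) (simp add: subgradient_oracle_def)
        moreover have "1 * 1 \<le> (?\<rho> g + 1) * M"
          using \<open>1 \<le> M\<close> rho_pos[OF \<open>\<epsilon> < norm g\<close>] by (intro mult_mono) auto
        ultimately have "?R g (Suc n) y w" using n False by (simp add: start)
        then show ?thesis by blast
      next
        case no: False
        obtain K p where K: "real K \<le> M" and p: "p \<in> cball x \<delta>" "G p (sgn g) \<bullet> sgn g < \<epsilon> / 2"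
          and run: "\<And>n z w. returns f G \<delta> \<epsilon> (test_stop \<epsilon> x (f x)
              (shortest_in_segment g (G p (sgn g)))) n z w \<Longrightarrow>
            returns f G \<delta> \<epsilon> (Probe x (f x) g) (K + n) z w"
          using probe_run[OF pos(1,2) G ball fin \<open>g \<noteq> 0\<close>] no unfolding M_def \<Lambda>_def by force
        define g' where "g' = shortest_in_segment g (G p (sgn g))"
        have seg: "g' \<in> closed_segment g (G p (sgn g))"
          unfolding g'_def by (rule shortest_in_segment)
        have g': "g' \<in> goldstein_subdifferential G \<delta> x"
          by (rule goldstein_combine[OF Suc.prems(2) p(1) seg])
        have "norm g' \<le> norm g" unfolding g'_def by (rule shortest_in_segment(2)) simp
        then have "norm g' \<le> L" using Suc.prems by simp
        have "g \<bullet> G p (sgn g) = norm g * (G p (sgn g) \<bullet> sgn g)"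
          using \<open>g \<noteq> 0\<close> by (simp add: sgn_div_norm inner_commute)
        also have "\<dots> \<le> norm g * (norm g / 2)"
          using p(2) \<open>\<epsilon> < norm g\<close> by (intro mult_left_mono) auto
        finally have "g \<bullet> G p (sgn g) \<le> (norm g)\<^sup>2 / 2" by (simp add: power2_eq_square)
        from norm_shortest_in_segment[OF pos(3) Suc.prems(3) bound this]
        have short: "(norm g')\<^sup>2 \<le> (norm g)\<^sup>2 - ((norm g)\<^sup>2)\<^sup>2 / (4 * L\<^sup>2)"
          by (simp add: g'_def)
        have gain: "?\<rho> g' \<le> ?\<rho> g - 1" if "\<epsilon> < norm g'"
          using inverse_norm_growth[OF pos(3) _ _ short] that \<open>g \<noteq> 0\<close> pos by force
        have "\<exists>n y w. ?R g' n y w"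
        proof (cases "norm g' \<le> \<epsilon>")
          case True
          then show ?thesis using g' by (auto simp: test_stop_def intro: returns.stop)
        next
          case False
          then show ?thesis
            using gain Suc.prems(1) g' \<open>norm g' \<le> L\<close> by (intro Suc.IH) auto
        qed
        then obtain n y w where n: "?R g' n y w" by blast
        have "real n \<le> ?\<rho> g * M + B"
        proof (cases "norm g' \<le> \<epsilon>")
          case True
          then show ?thesis
            using n rho_pos[OF \<open>\<epsilon> < norm g\<close>] \<open>1 \<le> M\<close> \<open>0 \<le> B\<close> by simp
        next
          case False
          then have "(?\<rho> g' + 1) * M \<le> ?\<rho> g * M"
            using gain \<open>1 \<le> M\<close> by (intro mult_right_mono) auto
          then show ?thesis using n False by simp
        qed
        then have "real (K + n) \<le> (?\<rho> g + 1) * M + B" using K by (simp add: distrib_right)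
        then have "?R g (K + n) y w"
          using n run[of n y w] False by (simp add: start g'_def)
        then show ?thesis by blast
      qed
    qed
  qed
qed

text \<open>If \<open>f x\<close> is less than \<open>j\<close> descents of size \<open>\<delta> \<epsilon> / 3\<close> above the lower bound \<open>b\<close>, then the
  algorithm visits at most \<open>j\<close> current points from \<open>x\<close> onwards, each at a cost of at most \<open>T\<close>.\<close>

lemma evaluate_run:
  fixes f :: "'a::real_inner \<Rightarrow> real" and \<delta> \<epsilon> L \<Lambda> :: real and C
  defines "\<Lambda> \<equiv> enn2real (nonconvexity_modulus C f \<delta>)"
  defines "T \<equiv> 4 * L\<^sup>2 / \<epsilon>\<^sup>2 * (1 + real_of_int \<lfloor>12 * \<Lambda> / \<epsilon>\<rfloor>)"
  assumes pos: "0 < \<delta>" "0 < \<epsilon>" and "\<epsilon> \<le> L" and G: "directional_subgradient_map C f G"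
    and bound: "\<And>x e. norm (G x e) \<le> L"
    and ball: "\<And>x. x \<in> C \<Longrightarrow> f x \<le> f x0 \<Longrightarrow> cball x \<delta> \<subseteq> C"
    and fin: "nonconvexity_modulus C f \<delta> < \<infinity>" and lower: "\<And>x. x \<in> C \<Longrightarrow> b \<le> f x"
    and x: "x \<in> C" "f x \<le> f x0" "f x - b < real j * (\<delta> * \<epsilon> / 3)"
  shows "\<exists>n y w. returns f G \<delta> \<epsilon> (Evaluate x) n y w \<and>
    w \<in> goldstein_subdifferential G \<delta> y \<and> norm w \<le> \<epsilon> \<and> real n \<le> real j * T"
  using x
proof (induction j arbitrary: x)
  case (0 x)
  then show ?case using lower[of x] by simp
next
  case (Suc j x)
  define M where "M = 1 + real_of_int \<lfloor>12 * \<Lambda> / \<epsilon>\<rfloor>"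
  have "1 \<le> M" using pos by (simp add: M_def \<Lambda>_def)
  have T: "T = 4 * L\<^sup>2 / \<epsilon>\<^sup>2 * M" by (simp add: T_def M_def)
  have "4 \<le> 4 * L\<^sup>2 / \<epsilon>\<^sup>2" using pos \<open>\<epsilon> \<le> L\<close> by (simp add: pos_le_divide_eq power_mono)
  then have "4 * 1 \<le> T" unfolding T using \<open>1 \<le> M\<close> by (intro mult_mono) auto
  let ?g = "G x 0"
  have start: "respond \<delta> \<epsilon> (Evaluate x) (subgradient_oracle f G (x, 0)) = test_stop \<epsilon> x (f x) ?g"
    by (simp add: subgradient_oracle_def)
  have "\<exists>n y w. returns f G \<delta> \<epsilon> (test_stop \<epsilon> x (f x) ?g) n y w \<and>
    w \<in> goldstein_subdifferential G \<delta> y \<and> norm w \<le> \<epsilon> \<and>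
    real n \<le> (if norm ?g \<le> \<epsilon> then 0
      else (4 * L\<^sup>2 / \<epsilon>\<^sup>2 - 4 * L\<^sup>2 / (norm ?g)\<^sup>2 + 1) * M + real j * T)"
    unfolding M_def \<Lambda>_def
  proof (rule test_stop_run[OF pos _ G bound ball[OF Suc.prems(1,2)] fin])
    fix x' assume x': "x' \<in> C" "\<delta> * \<epsilon> / 3 \<le> f x - f x'"
    have "0 < \<delta> * \<epsilon> / 3" using pos by simp
    then show "\<exists>n y w. returns f G \<delta> \<epsilon> (Evaluate x') n y w \<and>
        w \<in> goldstein_subdifferential G \<delta> y \<and> norm w \<le> \<epsilon> \<and> real n \<le> real j * T"
      using x' Suc.prems by (intro Suc.IH) (auto simp: distrib_right)
  qed (use pos \<open>\<epsilon> \<le> L\<close> \<open>4 * 1 \<le> T\<close> bound in \<open>auto intro: goldstein_base\<close>)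
  then obtain n y w where n: "returns f G \<delta> \<epsilon> (test_stop \<epsilon> x (f x) ?g) n y w"
    "w \<in> goldstein_subdifferential G \<delta> y" "norm w \<le> \<epsilon>"
    and le: "real n \<le> (if norm ?g \<le> \<epsilon> then 0
      else (4 * L\<^sup>2 / \<epsilon>\<^sup>2 - 4 * L\<^sup>2 / (norm ?g)\<^sup>2 + 1) * M + real j * T)"
    by blast
  have "real (Suc n) \<le> real (Suc j) * T"
  proof (cases "norm ?g \<le> \<epsilon>")
    case True
    have "1 * 1 \<le> real (Suc j) * T" using \<open>4 * 1 \<le> T\<close> by (intro mult_mono) auto
    then show ?thesis using le True by simp
  next
    case False
    then have "0 < norm ?g" using pos by linarith
    then have "4 \<le> 4 * L\<^sup>2 / (norm ?g)\<^sup>2"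
      using bound[of x 0] by (simp add: pos_le_divide_eq power_mono)
    then have "(4 * L\<^sup>2 / \<epsilon>\<^sup>2 - 4 * L\<^sup>2 / (norm ?g)\<^sup>2 + 1) * M \<le> (4 * L\<^sup>2 / \<epsilon>\<^sup>2 - 3) * M"
      using \<open>1 \<le> M\<close> by (intro mult_right_mono) auto
    also have "\<dots> = T - 3 * M" by (simp add: T left_diff_distrib)
    finally show ?thesis using le False \<open>1 \<le> M\<close> by (simp add: distrib_right)
  qed
  moreover have "returns f G \<delta> \<epsilon> (Evaluate x) (Suc n) y w"
    using n(1) by (intro returns.call[OF query.simps(1)]) (simp only: start)
  ultimately show ?case using n by blast
qed

theorem theorem6p6:
  fixes C :: "'a::real_inner set" and f :: "'a \<Rightarrow> real" and G :: "'a \<Rightarrow> 'a \<Rightarrow> 'a"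
    and \<delta> \<epsilon> L :: real and x0 :: 'a
  assumes "0 < \<delta>" and "0 < \<epsilon>" and "0 < L"
    and "convex C" and "bdd_below (f ` C)"
    and "directional_subgradient_map C f G"
    and "\<And>x e. norm (G x e) \<le> L"
    and "x0 \<in> C"
    and "\<And>x y. x \<in> C \<Longrightarrow> f x \<le> f x0 \<Longrightarrow> norm y \<le> \<delta> \<Longrightarrow> x + y \<in> C"
    and "nonconvexity_modulus C f \<delta> < \<infinity>"
  shows "\<exists>n x g. returns f G \<delta> \<epsilon> (Evaluate x0) n x g \<and>
    g \<in> goldstein_subdifferential G \<delta> x \<and> norm g \<le> \<epsilon> \<and>
    real n \<le> max 1
      (real_of_int (max 1 \<lceil>3 * (f x0 - (INF x\<in>C. f x)) / (\<delta> * \<epsilon>)\<rceil>)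
        * (16 * L\<^sup>2 / \<epsilon>\<^sup>2)
        * (1 + real_of_int \<lfloor>12 * enn2real (nonconvexity_modulus C f \<delta>) / \<epsilon>\<rfloor>))"
proof -
  define D where "D = 3 * (f x0 - (INF x\<in>C. f x)) / (\<delta> * \<epsilon>)"
  define M where "M = 1 + real_of_int \<lfloor>12 * enn2real (nonconvexity_modulus C f \<delta>) / \<epsilon>\<rfloor>"
  have lower: "(INF x\<in>C. f x) \<le> f x" if "x \<in> C" for x
    using assms(5) that by (rule cINF_lower)
  have ball: "cball x \<delta> \<subseteq> C" if "x \<in> C" "f x \<le> f x0" for x
  proof
    fix y assume "y \<in> cball x \<delta>"
    then show "y \<in> C"
      using assms(9)[OF that, of "y - x"] by (simp add: dist_norm norm_minus_commute)
  qed
  have "1 \<le> M" using assms(2) by (simp add: M_def)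
  show ?thesis
  proof (cases "\<epsilon> \<le> L")
    case False
    have "norm (G x0 0) \<le> \<epsilon>" using assms(7)[of x0 0] False by simp
    then have "returns f G \<delta> \<epsilon> (Evaluate x0) (Suc 0) x0 (G x0 0)"
      by (intro returns.call[OF query.simps(1)])
        (simp add: subgradient_oracle_def test_stop_def returns.stop)
    then show ?thesis
      using \<open>norm (G x0 0) \<le> \<epsilon>\<close> assms(1) goldstein_base[of x0 x0 \<delta> G 0] by force
  next
    case True
    have "0 \<le> D" using assms(1,2) lower[OF assms(8)] by (simp add: D_def)
    define j where "j = Suc (nat \<lfloor>D\<rfloor>)"
    have "D < real j" using \<open>0 \<le> D\<close> unfolding j_def by linarith
    then have "f x0 - (INF x\<in>C. f x) < real j * (\<delta> * \<epsilon> / 3)"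
      using assms(1,2) by (simp add: D_def field_simps)
    then obtain n y w where n: "returns f G \<delta> \<epsilon> (Evaluate x0) n y w"
      "w \<in> goldstein_subdifferential G \<delta> y" "norm w \<le> \<epsilon>"
      "real n \<le> real j * (4 * L\<^sup>2 / \<epsilon>\<^sup>2 * M)"
      using evaluate_run[OF assms(1,2) True assms(6,7) ball assms(10) lower assms(8) order_refl]
      unfolding M_def by blast
    \<comment> \<open>If \<open>D\<close> is a positive integer, \<open>j = D + 1\<close> is larger than \<open>\<lceil>D\<rceil>\<close>.\<close>
    have "real j \<le> real_of_int (max 1 \<lceil>D\<rceil>) * 2"
      using \<open>0 \<le> D\<close> unfolding j_def by linarith
    then have "real j * (4 * L\<^sup>2 / \<epsilon>\<^sup>2 * M) \<le> real_of_int (max 1 \<lceil>D\<rceil>) * 2 * (4 * L\<^sup>2 / \<epsilon>\<^sup>2 * M)"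
      using \<open>1 \<le> M\<close> by (intro mult_right_mono) auto
    also have "\<dots> \<le> real_of_int (max 1 \<lceil>D\<rceil>) * 4 * (4 * L\<^sup>2 / \<epsilon>\<^sup>2 * M)"
      using \<open>1 \<le> M\<close> by (intro mult_right_mono) auto
    also have "\<dots> = real_of_int (max 1 \<lceil>D\<rceil>) * (16 * L\<^sup>2 / \<epsilon>\<^sup>2) * M"
      by simp
    finally have "real n \<le> max 1 (real_of_int (max 1 \<lceil>D\<rceil>) * (16 * L\<^sup>2 / \<epsilon>\<^sup>2) * M)"
      using n(4) by linarith
    then show ?thesis using n(1-3) unfolding D_def M_def by blast
  qed
qed

end
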